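(* Assume that solving the eigenvalue problem in the coarsest spaces $V_{0H}(\Omega)$ and $V_{0h_1}(\Omega)$ needs work $\mathcal{O}(M_H)$ and $\mathcal{O}(M_{h_1})$, respectively, and that the work of solving the boundary value problem in $V_{h_k}(\Omega_j)$ and in $V_{h_k}(G_{m+1})$ is $\mathcal{O}(N_k^j)$ and $\mathcal{O}(N_k^{m+1})$, respectively, for all $k=1,2,\dots,n$ and $j=1,2,\dots,m$. Then the work involved in the multilevel correction scheme (defined in the context) is $$\mathcal{O}\big(N_n/m+M_H\log N_n+M_{h_1}\big)$$ for each processor. Furthermore, the complexity in each processor is $\mathcal{O}(N_n/m)$ provided $M_H\ll N_n/m$ and $M_{h_1}\le N_n/m$.
   Context: Setting. $\Omega\subset\mathbb{R}^d$ ($d=2,3$) is a bounded domain that can be decomposed into triangles or rectangles ($d=2$) or tetrahedrons or hexahedrons ($d=3$), $A$ is a symmetric, uniformly positive definite $d\times d$ matrix function on $\Omega$ with $W^{1,\infty}(\Omega)$ entries, $a(u,v)=(A\nabla u,\nabla v)$, $b(u,v)=(u,v)$ ($L^2$ inner product). The eigenvalue problem is: find $(\lambda,u)\in\mathbb{R}\times H_0^1(\Omega)$ with $b(u,u)=1$, $a(u,v)=\lambda b(u,v)$ for all $v\in H_0^1(\Omega)$; a simple eigenvalue is to be approximated. Domain decomposition. $G\subset\subset D$ means $\mathrm{dist}(\partial D\setminus\partial\Omega,\partial G\setminus\partial\Omega)>0$. $\Omega$ is divided into disjoint subdomains $D_1,\dots,D_m$ with $\bigcup_j\bar D_j=\bar\Omega$;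 each $D_j$ is enlarged to $\Omega_j$, aligned with a coarsest mesh $\mathcal{T}_H(\Omega)$; $G_j\subset\subset D_j\subset\Omega_j\subset\Omega$; $G_{m+1}=\Omega\setminus\bigcup_{j=1}^m\bar G_j$. Meshes and spaces. $\mathcal{T}_{h_1}(\Omega)$ is a regular refinement of $\mathcal{T}_H(\Omega)$, and $\mathcal{T}_{h_k}(\Omega)$ is obtained from $\mathcal{T}_{h_{k-1}}(\Omega)$ by regular refinement (each cell is split into $\beta^d$ congruent cells), so $h_k\approx\frac1\beta h_{k-1}$ for $k\ge2$. $V_h(\Omega)$ is the linear finite element space on $\mathcal{T}_h(\Omega)$, $V_{0h}(\Omega)=V_h(\Omega)\cap H_0^1(\Omega)$, $V_h(G)$ is the restriction of $V_h(\Omega)$ to a mesh-aligned $G$, and $V_{0h}(G)=V_h(G)\cap H_0^1(G)$, extended by zero to $\Omega$. The spaces are nested: $V_{0H}\subset V_{0h_1}\subset\cdots\subset V_{0h_n}$. Dimensions. $N_k=\dim V_{0h_k}(\Omega)$, $N_k^j=\dim V_{0h_k}(\Omega_j)$ for $j=1,\dots,m$, and $N_k^{m+1}=\dim V_{0h_k}(G_{m+1})$. They satisfy $N_k^j\approx(1/\beta)^{d(n-k)}N_n^j$ and $N_k^j\approx N_k/m$ for $k=1,\dots,n$, $j=1,\dots,m+1$, where $x\approx y$ means $cy\le x\le Cy$ with constants independent of the mesh sizes. One correction step, from $(\lambda_{h_k},u_{h_k})$ to $(\lambda_{h_{k+1}},u_{h_{k+1}})$: 1. For each $j=1,\dots,m$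 (in parallel) find $e^j_{h_{k+1}}\in V_{0h_{k+1}}(\Omega_j)$ with $a(e^j_{h_{k+1}},v)=\lambda_{h_k}b(u_{h_k},v)-a(u_{h_k},v)$ for all $v\in V_{0h_{k+1}}(\Omega_j)$, and set $\tilde u^j_{h_{k+1}}=u_{h_k}+e^j_{h_{k+1}}$. 2. Construct $\tilde u_{h_{k+1}}\in V_{0h_{k+1}}(\Omega)$ equal to $\tilde u^j_{h_{k+1}}$ in $G_j$ ($j=1,\dots,m$) and to $\tilde u^{m+1}_{h_{k+1}}$ in $G_{m+1}$, where $\tilde u^{m+1}_{h_{k+1}}\in V_{h_{k+1}}(G_{m+1})$ equals $\tilde u^j_{h_{k+1}}$ on $\partial G_j\cap\partial G_{m+1}$, vanishes on $\partial\Omega\cap\partial G_{m+1}$, and satisfies $a(\tilde u^{m+1}_{h_{k+1}},v)=\lambda_{h_k}b(u_{h_k},v)$ for all $v\in V_{0h_{k+1}}(G_{m+1})$. 3. Solve the eigenvalue problem in $V_{H,h_{k+1}}=V_{0H}(\Omega)+\mathrm{span}\{\tilde u_{h_{k+1}}\}$: find $(\lambda_{h_{k+1}},u_{h_{k+1}})\in\mathbb{R}\times V_{H,h_{k+1}}$ with $b(u_{h_{k+1}},u_{h_{k+1}})=1$ and $a(u_{h_{k+1}},v)=\lambda_{h_{k+1}}b(u_{h_{k+1}},v)$ for all $v\in V_{H,h_{k+1}}$. Multilevel correction scheme. Solve the discrete eigenvalue problem in $V_{0h_1}(\Omega)$ to get $(\lambda_{h_1},u_{h_1})$; then for $k=1,\dots,n-1$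 apply one correction step to get $(\lambda_{h_{k+1}},u_{h_{k+1}})$; output $(\lambda_{h_n},u_{h_n})$. Work model. There are $m$ processors, and the local problems of steps 1 and 2 are distributed so that each processor solves a bounded number of local boundary value problems per correction step. The work in a processor is the sum of the work of the boundary value problems it solves and of the eigenvalue problems; solving the eigenvalue problem in the augmented coarse space $V_{H,h_{k+1}}$ is counted as work $\mathcal{O}(M_H)$.
   Formalization: "M_H ≪ N_n/m" is taken as M_H = O((N_n/m)/ln(2+N_n/m)), uniformly, since M_H = o(N_n/m) alone does not absorb the about log(N_n/m) coarse eigenvalue solves; N_n ≥ 2 is assumed so that log N_n is not zero. *)

theory Defs
  imports
    "HOL-Analysis.Analysis"
    "HOL-Library.Function_Algebras"
    "HOL-Library.Landau_Symbols"
begin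

type_synonym 'd pt = "real ^ 'd"
type_synonym 'd fn = "real ^ 'd \<Rightarrow> real"

section \<open>Sobolev spaces and the bilinear forms\<close>

primrec C_diff :: "nat \<Rightarrow> ('d::finite) fn \<Rightarrow> bool" where
  "C_diff 0 f \<longleftrightarrow> continuous_on UNIV f"
| "C_diff (Suc k) f \<longleftrightarrow>
     (\<exists>g. (\<forall>x. (f has_derivative (\<lambda>h. \<Sum>i\<in>UNIV. h $ i * g i x)) (at x)) \<and>
          (\<forall>i. C_diff k (g i)))"

definition test_fun :: "('d::finite) pt set \<Rightarrow> 'd fn \<Rightarrow> bool" where
  "test_fun G \<phi> \<longleftrightarrow>
     (\<forall>k. C_diff k \<phi>) \<and> compact (closure {x. \<phi> x \<noteq> 0}) \<and> closure {x. \<phi> x \<noteq> 0} \<subseteq> G"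

definition grad :: "('d::finite) fn \<Rightarrow> 'd pt \<Rightarrow> 'd pt" where
  "grad \<phi> x = (\<chi> i. frechet_derivative \<phi> (at x) (axis i 1))"

definition L2 :: "('d::finite) pt set \<Rightarrow> 'd fn \<Rightarrow> bool" where
  "L2 G u \<longleftrightarrow>
     u \<in> borel_measurable (lebesgue_on G) \<and> integrable (lebesgue_on G) (\<lambda>x. (u x)\<^sup>2)"

definition Linf :: "('d::finite) pt set \<Rightarrow> 'd fn \<Rightarrow> bool" where
  "Linf G u \<longleftrightarrow>
     u \<in> borel_measurable (lebesgue_on G) \<and> (\<exists>C. AE x in lebesgue_on G. \<bar>u x\<bar> \<le> C)"

definition weak_partial :: "('d::finite) pt set \<Rightarrow> 'd \<Rightarrow> 'd fn \<Rightarrow> 'd fn \<Rightarrow> bool" where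
  "weak_partial G i u g \<longleftrightarrow>
     (\<forall>\<phi>. test_fun G \<phi> \<longrightarrow>
        (\<integral>x. u x * grad \<phi> x $ i \<partial>lebesgue_on G) = - (\<integral>x. g x * \<phi> x \<partial>lebesgue_on G))"

definition is_weak_grad :: "('d::finite) pt set \<Rightarrow> 'd fn \<Rightarrow> ('d pt \<Rightarrow> 'd pt) \<Rightarrow> bool" where
  "is_weak_grad G u g \<longleftrightarrow> (\<forall>i. L2 G (\<lambda>x. g x $ i) \<and> weak_partial G i u (\<lambda>x. g x $ i))"

text \<open>The weak gradient is unique only almost everywhere; it is used below only inside
  integrals over the same open set.\<close>

definition weak_grad :: "('d::finite) pt set \<Rightarrow> 'd fn \<Rightarrow> 'd pt \<Rightarrow> 'd pt" where
  "weak_grad G u = (SOME g. is_weak_grad G u g)"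

definition H1 :: "('d::finite) pt set \<Rightarrow> 'd fn set" where
  "H1 G = {u. L2 G u \<and> (\<exists>g. is_weak_grad G u g)}"

text \<open>The closure of the test functions in the \<open>H1\<close> norm.\<close>

definition H10 :: "('d::finite) pt set \<Rightarrow> 'd fn set" where
  "H10 G = {u \<in> H1 G. \<exists>\<phi>. (\<forall>n::nat. test_fun G (\<phi> n)) \<and>
      (\<lambda>n. \<integral>x. (u x - \<phi> n x)\<^sup>2 + (norm (weak_grad G u x - grad (\<phi> n) x))\<^sup>2 \<partial>lebesgue_on G)
        \<longlonglongrightarrow> 0}"

definition W1inf :: "('d::finite) pt set \<Rightarrow> 'd fn \<Rightarrow> bool" where
  "W1inf G u \<longleftrightarrow> Linf G u \<and> (\<forall>i. \<exists>g. Linf G g \<and> weak_partial G i u g)"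

definition a_form ::
  "(('d::finite) pt \<Rightarrow> real ^ 'd ^ 'd) \<Rightarrow> 'd pt set \<Rightarrow> 'd fn \<Rightarrow> 'd fn \<Rightarrow> real" where
  "a_form A G u v = (\<integral>x. (A x *v weak_grad G u x) \<bullet> weak_grad G v x \<partial>lebesgue_on G)"

definition b_form :: "('d::finite) pt set \<Rightarrow> 'd fn \<Rightarrow> 'd fn \<Rightarrow> real" where
  "b_form G u v = (\<integral>x. u x * v x \<partial>lebesgue_on G)"

definition problem_data :: "('d::finite) pt set \<Rightarrow> ('d pt \<Rightarrow> real ^ 'd ^ 'd) \<Rightarrow> bool" where
  "problem_data \<Omega> A \<longleftrightarrow>
     open \<Omega> \<and> connected \<Omega> \<and> bounded \<Omega> \<and> \<Omega> \<noteq> {} \<and>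
     (\<forall>x\<in>\<Omega>. transpose (A x) = A x) \<and>
     (\<exists>\<alpha>>0. \<forall>x\<in>\<Omega>. \<forall>\<xi>. \<alpha> * (norm \<xi>)\<^sup>2 \<le> (A x *v \<xi>) \<bullet> \<xi>) \<and>
     (\<forall>i j. W1inf \<Omega> (\<lambda>x. A x $ i $ j))"

text \<open>The eigenvalue problem posed in a space \<open>V\<close>; the continuous problem is
  \<open>V = H10 \<Omega>\<close>.\<close>

definition eigenpair ::
  "(('d::finite) pt \<Rightarrow> real ^ 'd ^ 'd) \<Rightarrow> 'd pt set \<Rightarrow> 'd fn set \<Rightarrow> real \<Rightarrow> 'd fn \<Rightarrow> bool" where
  "eigenpair A \<Omega> V l u \<longleftrightarrow>
     u \<in> V \<and> b_form \<Omega> u u = 1 \<and> (\<forall>v\<in>V. a_form A \<Omega> u v = l * b_form \<Omega> u v)"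

definition simple_eigenvalue ::
  "('d::finite) pt set \<Rightarrow> ('d pt \<Rightarrow> real ^ 'd ^ 'd) \<Rightarrow> real \<Rightarrow> bool" where
  "simple_eigenvalue \<Omega> A l \<longleftrightarrow>
     (\<exists>u. eigenpair A \<Omega> (H10 \<Omega>) l u \<and>
        (\<forall>w. eigenpair A \<Omega> (H10 \<Omega>) l w \<longrightarrow> (\<exists>c. AE x in lebesgue_on \<Omega>. w x = c * u x)))"


section \<open>Meshes and finite element spaces\<close>

definition multi_affine :: "(real ^ ('d::finite) \<Rightarrow> 'b::real_vector) \<Rightarrow> bool" where
  "multi_affine q \<longleftrightarrow>
     (\<exists>c. \<forall>x. q x = (\<Sum>S\<in>(UNIV :: 'd set set). (\<Prod>i\<in>S. x $ i) *\<^sub>R c S))"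

text \<open>A cell is a triangle or tetrahedron, given by its set of vertices, or a rectangle or
  hexahedron, given by a map from the unit cube.\<close>

datatype ('d::finite) cell = Simp "(real ^ 'd) set" | Brick "real ^ 'd \<Rightarrow> real ^ 'd"

primrec cell_set :: "('d::finite) cell \<Rightarrow> 'd pt set" where
  "cell_set (Simp V) = convex hull V"
| "cell_set (Brick F) = F ` cbox 0 1"

definition rectangle_map :: "(('d::finite) pt \<Rightarrow> 'd pt) \<Rightarrow> bool" where
  "rectangle_map F \<longleftrightarrow>
     (\<exists>p e. (\<forall>x. F x = p + (\<Sum>i\<in>UNIV. x $ i *\<^sub>R e i)) \<and>
            (\<forall>i j. i \<noteq> j \<longrightarrow> e i \<bullet> e j = 0))"

text \<open>In three dimensions a hexahedron is, as usual for finite elements, an injective trilinear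
  image of the unit cube.\<close>

primrec valid_cell :: "('d::finite) cell \<Rightarrow> bool" where
  "valid_cell (Simp V) \<longleftrightarrow> card V = CARD('d) + 1 \<and> \<not> affine_dependent V"
| "valid_cell (Brick F) \<longleftrightarrow>
     multi_affine F \<and> inj_on F (cbox 0 1) \<and> (CARD('d) = 2 \<longrightarrow> rectangle_map F)"

primrec cell_faces :: "('d::finite) cell \<Rightarrow> 'd pt set set" where
  "cell_faces (Simp V) = {T. T face_of (convex hull V)}"
| "cell_faces (Brick F) = {F ` T | T. T face_of cbox 0 1}"

text \<open>The restriction of a linear finite element function to a cell: affine on simplices, and
  multilinear in the reference coordinates on rectangles and hexahedra.\<close>

primrec shape_fun :: "('d::finite) cell \<Rightarrow> 'd fn \<Rightarrow> bool" where
  "shape_fun (Simp V) u \<longleftrightarrow> (\<exists>g c. \<forall>x\<in>convex hull V. u x = g \<bullet> x + c)"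
| "shape_fun (Brick F) u \<longleftrightarrow> (\<exists>q. multi_affine q \<and> (\<forall>x\<in>cbox 0 1. u (F x) = q x))"

definition aligned :: "('d::finite) cell set \<Rightarrow> 'd pt set \<Rightarrow> bool" where
  "aligned T G \<longleftrightarrow>
     (\<exists>S\<subseteq>T. closure G = \<Union> (cell_set ` S) \<and> (\<forall>K\<in>S. interior (cell_set K) \<subseteq> G))"

definition is_mesh :: "('d::finite) pt set \<Rightarrow> 'd cell set \<Rightarrow> bool" where
  "is_mesh \<Omega> T \<longleftrightarrow>
     finite T \<and> (\<forall>K\<in>T. valid_cell K \<and> interior (cell_set K) \<subseteq> \<Omega>) \<and>
     closure \<Omega> = \<Union> (cell_set ` T) \<and>
     (\<forall>K\<in>T. \<forall>L\<in>T. K \<noteq> L \<longrightarrow>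
        interior (cell_set K) \<inter> interior (cell_set L) = {} \<and>
        cell_set K \<inter> cell_set L \<in> cell_faces K \<inter> cell_faces L)"

definition mesh_size :: "('d::finite) cell set \<Rightarrow> real" where
  "mesh_size T = Max ((\<lambda>K. diameter (cell_set K)) ` T)"

definition congruent_sets :: "('d::finite) pt set \<Rightarrow> 'd pt set \<Rightarrow> bool" where
  "congruent_sets S T \<longleftrightarrow> (\<exists>f. (\<forall>x y. dist (f x) (f y) = dist x y) \<and> f ` S = T)"

text \<open>\<open>T'\<close> arises from \<open>T\<close> by splitting each cell into \<open>\<beta> ^ d\<close> congruent cells.\<close>

definition regular_refinement :: "nat \<Rightarrow> ('d::finite) cell set \<Rightarrow> 'd cell set \<Rightarrow> bool" where
  "regular_refinement \<beta> T T' \<longleftrightarrow>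
     (\<forall>L\<in>T'. \<exists>K\<in>T. cell_set L \<subseteq> cell_set K) \<and>
     (\<forall>K\<in>T. \<exists>S\<subseteq>T'. card S = \<beta> ^ CARD('d) \<and> \<Union> (cell_set ` S) = cell_set K \<and>
        (\<forall>L\<in>S. \<forall>M\<in>S. congruent_sets (cell_set L) (cell_set M)))"

text \<open>All functions are defined on the whole space; finite element functions on \<open>G\<close> are
  normalised to vanish off \<open>closure G\<close>, so that they can be counted as functions on
  \<open>closure G\<close>, and so that members of \<open>V0 \<Omega> T G\<close> are automatically extended by zero.\<close>

definition V_full :: "('d::finite) pt set \<Rightarrow> 'd cell set \<Rightarrow> 'd fn set" where
  "V_full \<Omega> T = {u. continuous_on (closure \<Omega>) u \<and> (\<forall>K\<in>T. shape_fun K u) \<and>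
                    (\<forall>x. x \<notin> closure \<Omega> \<longrightarrow> u x = 0)}"

definition V_on :: "('d::finite) pt set \<Rightarrow> 'd cell set \<Rightarrow> 'd pt set \<Rightarrow> 'd fn set" where
  "V_on \<Omega> T G = (\<lambda>u x. if x \<in> closure G then u x else 0) ` V_full \<Omega> T"

definition V0 :: "('d::finite) pt set \<Rightarrow> 'd cell set \<Rightarrow> 'd pt set \<Rightarrow> 'd fn set" where
  "V0 \<Omega> T G = V_on \<Omega> T G \<inter> H10 G"

definition fun_dim :: "('d::finite) fn set \<Rightarrow> nat" where
  "fun_dim V = vector_space.dim (\<lambda>(c::real) u x. c * u x) V"


section \<open>The multilevel correction scheme\<close>

text \<open>Level \<open>k\<close> of \<open>fmesh\<close> is the mesh with size \<open>h_k\<close>, \<open>1 \<le> k \<le> levels\<close>.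
  The entries of \<open>corr k\<close>, \<open>loc k\<close> and \<open>glob k\<close> are the functions \<open>e\<close>, the local
  \<open>u\<close> tilde and the global \<open>u\<close> tilde with mesh index \<open>h_k\<close>; the second
  argument of \<open>corr\<close> and \<open>loc\<close> is the subdomain.\<close>

record ('d::finite) mlc_run =
  nproc :: nat
  levels :: nat
  coarse :: "'d cell set"
  fmesh :: "nat \<Rightarrow> 'd cell set"
  D_dom :: "nat \<Rightarrow> (real ^ 'd) set"
  O_dom :: "nat \<Rightarrow> (real ^ 'd) set"
  G_dom :: "nat \<Rightarrow> (real ^ 'd) set"
  eval_at :: "nat \<Rightarrow> real"
  efun_at :: "nat \<Rightarrow> real ^ 'd \<Rightarrow> real"
  corr :: "nat \<Rightarrow> nat \<Rightarrow> real ^ 'd \<Rightarrow> real"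
  loc :: "nat \<Rightarrow> nat \<Rightarrow> real ^ 'd \<Rightarrow> real"
  glob :: "nat \<Rightarrow> real ^ 'd \<Rightarrow> real"

text \<open>Spelled out because \<^const>\<open>setdist\<close> is 0 when one of the sets is empty, whereas the
  distance to an empty set has to count as positive here.\<close>

definition strongly_inside :: "('d::finite) pt set \<Rightarrow> 'd pt set \<Rightarrow> 'd pt set \<Rightarrow> bool" where
  "strongly_inside \<Omega> G D \<longleftrightarrow> G \<subseteq> D \<and>
     (\<exists>\<delta>>0. \<forall>x\<in>frontier D - frontier \<Omega>. \<forall>y\<in>frontier G - frontier \<Omega>. \<delta> \<le> dist x y)"

definition G_last :: "('d::finite) pt set \<Rightarrow> 'd mlc_run \<Rightarrow> 'd pt set" where
  "G_last \<Omega> R = \<Omega> - (\<Union>j\<in>{1..nproc R}. closure (G_dom R j))"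

text \<open>The region of the \<open>j\<close>-th local problem, \<open>1 \<le> j \<le> m + 1\<close>.\<close>

definition region :: "('d::finite) pt set \<Rightarrow> 'd mlc_run \<Rightarrow> nat \<Rightarrow> 'd pt set" where
  "region \<Omega> R j = (if j \<le> nproc R then O_dom R j else G_last \<Omega> R)"

definition decomposition :: "('d::finite) pt set \<Rightarrow> 'd mlc_run \<Rightarrow> bool" where
  "decomposition \<Omega> R \<longleftrightarrow>
     1 \<le> nproc R \<and>
     (\<forall>j\<in>{1..nproc R}.
        open (D_dom R j) \<and> D_dom R j \<noteq> {} \<and> open (O_dom R j) \<and> open (G_dom R j) \<and>
        strongly_inside \<Omega> (G_dom R j) (D_dom R j) \<and>
        D_dom R j \<subseteq> O_dom R j \<and> O_dom R j \<subseteq> \<Omega> \<and> aligned (coarse R) (O_dom R j)) \<and>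
     (\<forall>i\<in>{1..nproc R}. \<forall>j\<in>{1..nproc R}. i \<noteq> j \<longrightarrow> D_dom R i \<inter> D_dom R j = {}) \<and>
     (\<Union>j\<in>{1..nproc R}. closure (D_dom R j)) = closure \<Omega> \<and>
     aligned (fmesh R 1) (G_last \<Omega> R)"

definition mesh_hierarchy :: "('d::finite) pt set \<Rightarrow> nat \<Rightarrow> 'd mlc_run \<Rightarrow> bool" where
  "mesh_hierarchy \<Omega> \<beta> R \<longleftrightarrow>
     1 \<le> levels R \<and>
     is_mesh \<Omega> (coarse R) \<and> (\<forall>k\<in>{1..levels R}. is_mesh \<Omega> (fmesh R k)) \<and>
     (\<exists>\<gamma>\<ge>1. regular_refinement \<gamma> (coarse R) (fmesh R 1)) \<and>
     (\<forall>k\<in>{1..<levels R}. regular_refinement \<beta> (fmesh R k) (fmesh R (k + 1))) \<and>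
     V0 \<Omega> (coarse R) \<Omega> \<subseteq> V0 \<Omega> (fmesh R 1) \<Omega> \<and>
     (\<forall>k\<in>{1..<levels R}. V0 \<Omega> (fmesh R k) \<Omega> \<subseteq> V0 \<Omega> (fmesh R (k + 1)) \<Omega>)"

definition aug_space :: "('d::finite) pt set \<Rightarrow> 'd mlc_run \<Rightarrow> nat \<Rightarrow> 'd fn set" where
  "aug_space \<Omega> R k = {\<lambda>x. v x + c * glob R k x | v c. v \<in> V0 \<Omega> (coarse R) \<Omega>}"

text \<open>The correction step from level \<open>k\<close> to level \<open>k + 1\<close>. The equation on the last
  region is integrated over that region only, since the unknown there is not defined elsewhere
  and the test functions vanish elsewhere.\<close>

definition correction_step ::
  "('d::finite) pt set \<Rightarrow> ('d pt \<Rightarrow> real ^ 'd ^ 'd) \<Rightarrow> 'd mlc_run \<Rightarrow> nat \<Rightarrow> bool" where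
  "correction_step \<Omega> A R k \<longleftrightarrow>
    (let m = nproc R; T = fmesh R (k + 1); l = eval_at R k; u = efun_at R k;
         e = corr R (k + 1); w = loc R (k + 1); ut = glob R (k + 1); E = G_last \<Omega> R in
     (\<forall>j\<in>{1..m}.
        e j \<in> V0 \<Omega> T (O_dom R j) \<and>
        (\<forall>v\<in>V0 \<Omega> T (O_dom R j). a_form A \<Omega> (e j) v = l * b_form \<Omega> u v - a_form A \<Omega> u v) \<and>
        w j = (\<lambda>x. u x + e j x)) \<and>
     w (m + 1) \<in> V_on \<Omega> T E \<and>
     (\<forall>j\<in>{1..m}. \<forall>x\<in>frontier (G_dom R j) \<inter> frontier E. w (m + 1) x = w j x) \<and>
     (\<forall>x\<in>frontier \<Omega> \<inter> frontier E. w (m + 1) x = 0) \<and>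
     (\<forall>v\<in>V0 \<Omega> T E. a_form A E (w (m + 1)) v = l * b_form E u v) \<and>
     ut \<in> V0 \<Omega> T \<Omega> \<and>
     (\<forall>j\<in>{1..m}. \<forall>x\<in>G_dom R j. ut x = w j x) \<and>
     (\<forall>x\<in>E. ut x = w (m + 1) x) \<and>
     eigenpair A \<Omega> (aug_space \<Omega> R (k + 1)) (eval_at R (k + 1)) (efun_at R (k + 1)))"

definition multilevel_correction ::
  "('d::finite) pt set \<Rightarrow> ('d pt \<Rightarrow> real ^ 'd ^ 'd) \<Rightarrow> nat \<Rightarrow> 'd mlc_run \<Rightarrow> bool" where
  "multilevel_correction \<Omega> A \<beta> R \<longleftrightarrow>
     mesh_hierarchy \<Omega> \<beta> R \<and> decomposition \<Omega> R \<and>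
     eigenpair A \<Omega> (V0 \<Omega> (fmesh R 1) \<Omega>) (eval_at R 1) (efun_at R 1) \<and>
     (\<forall>k\<in>{1..<levels R}. correction_step \<Omega> A R k)"


section \<open>Dimensions and work\<close>

definition dim_level :: "('d::finite) pt set \<Rightarrow> 'd mlc_run \<Rightarrow> nat \<Rightarrow> nat" where
  "dim_level \<Omega> R k = fun_dim (V0 \<Omega> (fmesh R k) \<Omega>)"

definition dim_local :: "('d::finite) pt set \<Rightarrow> 'd mlc_run \<Rightarrow> nat \<Rightarrow> nat \<Rightarrow> nat" where
  "dim_local \<Omega> R k j = fun_dim (V0 \<Omega> (fmesh R k) (region \<Omega> R j))"

definition dim_per_proc :: "('d::finite) pt set \<Rightarrow> 'd mlc_run \<Rightarrow> real" where
  "dim_per_proc \<Omega> R = real (dim_level \<Omega> R (levels R)) / real (nproc R)"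

text \<open>\<open>bvp V\<close> and \<open>evp V\<close> are the costs of a boundary value problem and of an eigenvalue
  problem in the space \<open>V\<close>; \<open>jobs k p\<close> is the set of local problems that processor \<open>p\<close>
  solves in the correction step from level \<open>k\<close> to level \<open>k + 1\<close>. The eigenvalue problems
  are charged to every processor.\<close>

definition processor_work ::
  "('d::finite) pt set \<Rightarrow> 'd mlc_run \<Rightarrow> ('d fn set \<Rightarrow> real) \<Rightarrow> ('d fn set \<Rightarrow> real) \<Rightarrow>
   (nat \<Rightarrow> nat \<Rightarrow> nat set) \<Rightarrow> nat \<Rightarrow> real" where
  "processor_work \<Omega> R bvp evp jobs p =
     evp (V0 \<Omega> (fmesh R 1) \<Omega>) +
     (\<Sum>k\<in>{1..<levels R}.
        (\<Sum>j\<in>jobs k p. bvp (V0 \<Omega> (fmesh R (k + 1)) (region \<Omega> R j))) +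
        evp (aug_space \<Omega> R (k + 1)))"

definition job_distribution :: "nat \<Rightarrow> ('d::finite) mlc_run \<Rightarrow> (nat \<Rightarrow> nat \<Rightarrow> nat set) \<Rightarrow> bool" where
  "job_distribution B R jobs \<longleftrightarrow>
     (\<forall>k\<in>{1..<levels R}.
        (\<Union>p\<in>{1..nproc R}. jobs k p) = {1..nproc R + 1} \<and>
        (\<forall>p\<in>{1..nproc R}. card (jobs k p) \<le> B))"

text \<open>Over the family \<open>I\<close>, \<open>f\<close> is smaller than \<open>g\<close> by at least a logarithmic factor,
  uniformly. This holds for instance if \<open>f\<close> is \<open>O\<close> of a power of \<open>g\<close> with exponent below 1 and
  \<open>g\<close> is bounded away from 0. Mere \<open>f\<close> in \<open>o(g)\<close> would not absorb the number of correction
  steps, which grows like \<open>ln g\<close>. The 2 keeps the logarithm positive.\<close>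

definition much_smaller :: "'i set \<Rightarrow> ('i \<Rightarrow> real) \<Rightarrow> ('i \<Rightarrow> real) \<Rightarrow> bool" where
  "much_smaller I f g \<longleftrightarrow> f \<in> O[principal I](\<lambda>i. g i / ln (2 + g i))"

end

theory Submission
  imports Defs
begin

text \<open>On each level a processor solves at most \<open>B\<close> local problems. Their cost decays
  geometrically from the finest level downwards, so over all levels they cost no more than
  \<open>O(N\<^sub>n / m)\<close>. For the eigenvalue problems it remains to count the levels: a coarsest local space
  is nonzero, hence has dimension at least 1, and dimensions grow by a factor
  \<open>\<beta>\<^sup>d\<close> per level up to \<open>O(N\<^sub>n / m)\<close>, so \<open>n - 1 = O(ln (2 + N\<^sub>n / m))\<close>. This sharper form of
  \<open>n = O(ln N\<^sub>n)\<close> is what the second claim needs, where \<open>M\<^sub>H\<close> is compared with \<open>N\<^sub>n / m\<close>.\<close>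

text \<open>Eventually in a principal filter means everywhere on the set, so a Landau bound here is
  one constant serving all runs, levels and regions at once. This is how uniformity enters.\<close>

lemma bigo_principal_iff:
  fixes f g :: "'a \<Rightarrow> real"
  shows "f \<in> O[principal S](g) \<longleftrightarrow> (\<exists>c>0. \<forall>x\<in>S. \<bar>f x\<bar> \<le> c * \<bar>g x\<bar>)"
  by (simp add: bigo_def eventually_principal)

lemma bigtheta_principal_iff:
  fixes f g :: "'a \<Rightarrow> real"
  shows "f \<in> \<Theta>[principal S](g) \<longleftrightarrow>
    (\<exists>c>0. \<forall>x\<in>S. \<bar>f x\<bar> \<le> c * \<bar>g x\<bar>) \<and> (\<exists>c>0. \<forall>x\<in>S. \<bar>g x\<bar> \<le> c * \<bar>f x\<bar>)"
  by (simp add: bigtheta_def bigomega_iff_bigo bigo_principal_iff)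

text \<open>The slowest decay occurs for \<open>d = 1\<close> and \<open>\<beta> = 2\<close>.
  Reducing to the ratio 1/2 keeps later constants free of both parameters.\<close>

lemma inverse_power_le_half_power:
  fixes \<beta> d m :: nat
  assumes "2 \<le> \<beta>" "1 \<le> d"
  shows "(1 / real \<beta>) ^ (d * m) \<le> (1 / 2) ^ m"
proof -
  have "(1 / real \<beta>) ^ (d * m) \<le> (1 / real \<beta>) ^ m"
    using assms by (intro power_decreasing) auto
  also have "\<dots> \<le> (1 / 2) ^ m"
    using assms by (intro power_mono) (auto simp: field_simps)
  finally show ?thesis .
qed

text \<open>Step \<open>k\<close> works on mesh \<open>k + 1\<close>, hence the shifted exponent.
  Reversing the order of summation turns the majorant into a partial sum of the geometric series
  with ratio 1/2.\<close>

lemma sum_inverse_powers_le: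
  fixes \<beta> d n :: nat
  assumes "2 \<le> \<beta>" "1 \<le> d"
  shows "(\<Sum>k\<in>{1..<n}. (1 / real \<beta>) ^ (d * (n - (k + 1)))) \<le> 2"
proof -
  have "(\<Sum>k\<in>{1..<n}. (1 / real \<beta>) ^ (d * (n - (k + 1)))) \<le> (\<Sum>k\<in>{1..<n}. (1 / 2) ^ (n - Suc k))"
    by (intro sum_mono) (use inverse_power_le_half_power[OF assms] in simp)
  also have "\<dots> \<le> (\<Sum>k<n. (1 / 2) ^ (n - Suc k))"
    by (intro sum_mono2) auto
  also have "\<dots> = (\<Sum>k<n. (1 / 2) ^ k)"
    by (rule sum.nat_diff_reindex)
  also have "\<dots> \<le> (2 :: real)"
    by (simp add: geometric_sum)
  finally show ?thesis .
qed

text \<open>The hypothesis gives \<open>2 ^ m \<le> K * g\<close>; then take logarithms. Enlarging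
  \<open>g\<close> to \<open>2 + g\<close> makes the logarithm at least \<open>ln 2\<close>, so it
  can absorb the additive constant \<open>\<bar>ln K\<bar>\<close> even when \<open>g\<close> is
  small.\<close>

lemma levels_le_ln:
  fixes \<beta> d m :: nat and g K :: real
  assumes "2 \<le> \<beta>" "1 \<le> d" "0 \<le> g" "0 < K"
    and le: "1 \<le> K * (1 / real \<beta>) ^ (d * m) * g"
  shows "real m \<le> (\<bar>ln K\<bar> / ln 2 + 1) / ln 2 * ln (2 + g)"
proof -
  have "1 \<le> K * (1 / 2) ^ m * g"
    using inverse_power_le_half_power[OF assms(1,2), of m] assms(3,4)
    by (intro order_trans[OF le] mult_right_mono mult_left_mono) auto
  then have "2 ^ m \<le> K * g"
    by (simp add: field_simps)
  also have "\<dots> \<le> K * (2 + g)"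
    using \<open>0 < K\<close> by simp
  finally have "ln (2 ^ m) \<le> ln (K * (2 + g))"
    using assms(3,4) by (subst ln_le_cancel_iff) auto
  then have "real m * ln 2 \<le> ln K + ln (2 + g)"
    using assms(3,4) by (simp add: ln_realpow ln_mult)
  moreover have "\<bar>ln K\<bar> \<le> \<bar>ln K\<bar> / ln 2 * ln (2 + g)"
  proof -
    have "\<bar>ln K\<bar> / ln 2 * ln 2 \<le> \<bar>ln K\<bar> / ln 2 * ln (2 + g)"
      using assms(3) by (intro mult_left_mono) auto
    then show ?thesis by simp
  qed
  ultimately have "real m * ln 2 \<le> (\<bar>ln K\<bar> / ln 2 + 1) * ln (2 + g)"
    by (simp add: algebra_simps)
  then show ?thesis
    by (simp add: field_simps)
qed

text \<open>Converts the intrinsic level count into the \<open>ln N\<close> of the first claim,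
  through \<open>2 + g \<le> 2 * N \<le> N ^ 2\<close>. The lower bound 2 on the global dimension
  enters here.\<close>

lemma ln_two_plus_le:
  fixes g N :: real
  assumes "2 \<le> N" "0 \<le> g" "g \<le> N"
  shows "ln (2 + g) \<le> 2 * ln N"
proof -
  have "2 + g \<le> 2 * N"
    using assms by simp
  also have "\<dots> \<le> N ^ 2"
    using assms by (simp add: power2_eq_square)
  finally have "ln (2 + g) \<le> ln (N ^ 2)"
    using assms by (subst ln_le_cancel_iff) auto
  then show ?thesis
    using assms by (simp add: ln_realpow)
qed

theorem theorem5p1:
  fixes \<Omega> :: "(real ^ 'd::finite) set"
    and A :: "real ^ 'd \<Rightarrow> real ^ 'd ^ 'd"
    and lam :: real
    and \<beta> :: nat
    and I :: "'i set"
    and R :: "'i \<Rightarrow> 'd mlc_run"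
    and bvp evp :: "'i \<Rightarrow> 'd fn set \<Rightarrow> real"
    and jobs :: "'i \<Rightarrow> nat \<Rightarrow> nat \<Rightarrow> nat set"
    and B :: nat
    and M_H M_h1 :: "'i \<Rightarrow> real"
  assumes dim: "CARD('d) = 2 \<or> CARD('d) = 3"
    and data: "problem_data \<Omega> A"
    and simple: "simple_eigenvalue \<Omega> A lam"
    and beta: "2 \<le> \<beta>"
    and run: "\<And>i. i \<in> I \<Longrightarrow> multilevel_correction \<Omega> A \<beta> (R i)"
    and nontrivial: "\<And>i. i \<in> I \<Longrightarrow> 2 \<le> dim_level \<Omega> (R i) (levels (R i))"
    and mesh_sizes:
      "(\<lambda>(i, k). mesh_size (fmesh (R i) k))
         \<in> \<Theta>[principal {(i, k). i \<in> I \<and> k \<in> {2..levels (R i)}}](\<lambda>(i, k). 1 / real \<beta> * mesh_size (fmesh (R i) (k - 1)))"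
    and dims_levels:
      "(\<lambda>(i, k, j). real (dim_local \<Omega> (R i) k j))
         \<in> \<Theta>[principal {(i, k, j). i \<in> I \<and> k \<in> {1..levels (R i)} \<and> j \<in> {1..nproc (R i) + 1}}](\<lambda>(i, k, j). (1 / real \<beta>) ^ (CARD('d) * (levels (R i) - k)) *
                         real (dim_local \<Omega> (R i) (levels (R i)) j))"
    and dims_local:
      "(\<lambda>(i, k, j). real (dim_local \<Omega> (R i) k j))
         \<in> \<Theta>[principal {(i, k, j). i \<in> I \<and> k \<in> {1..levels (R i)} \<and> j \<in> {1..nproc (R i) + 1}}](\<lambda>(i, k, j). real (dim_level \<Omega> (R i) k) / real (nproc (R i)))"
    and distributed: "\<And>i. i \<in> I \<Longrightarrow> job_distribution B (R i) (jobs i)"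
    and M_nonneg: "\<And>i. i \<in> I \<Longrightarrow> 0 \<le> M_H i \<and> 0 \<le> M_h1 i"
    and work_coarse:
      "(\<lambda>i. evp i (V0 \<Omega> (coarse (R i)) \<Omega>)) \<in> O[principal I](M_H)"
    and work_augmented:
      "(\<lambda>(i, k). evp i (aug_space \<Omega> (R i) k))
         \<in> O[principal {(i, k). i \<in> I \<and> k \<in> {2..levels (R i)}}](\<lambda>(i, k). M_H i)"
    and work_first:
      "(\<lambda>i. evp i (V0 \<Omega> (fmesh (R i) 1) \<Omega>)) \<in> O[principal I](M_h1)"
    and work_local:
      "(\<lambda>(i, k, j). bvp i (V0 \<Omega> (fmesh (R i) k) (region \<Omega> (R i) j)))
         \<in> O[principal {(i, k, j). i \<in> I \<and> k \<in> {1..levels (R i)} \<and> j \<in> {1..nproc (R i) + 1}}](\<lambda>(i, k, j). real (dim_local \<Omega> (R i) k j))"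
  shows
    "(\<lambda>(i, p). processor_work \<Omega> (R i) (bvp i) (evp i) (jobs i) p)
       \<in> O[principal {(i, p). i \<in> I \<and> p \<in> {1..nproc (R i)}}](\<lambda>(i, p). dim_per_proc \<Omega> (R i) +
                    M_H i * ln (real (dim_level \<Omega> (R i) (levels (R i)))) + M_h1 i)
     \<and>
     (much_smaller I M_H (\<lambda>i. dim_per_proc \<Omega> (R i)) \<and>
      (\<forall>i\<in>I. M_h1 i \<le> dim_per_proc \<Omega> (R i)) \<longrightarrow>
      (\<lambda>(i, p). processor_work \<Omega> (R i) (bvp i) (evp i) (jobs i) p)
        \<in> O[principal {(i, p). i \<in> I \<and> p \<in> {1..nproc (R i)}}](\<lambda>(i, p). dim_per_proc \<Omega> (R i)))"
proof -

  \<comment> \<open>Notation and uniform constants\<close>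
  define N where "N i = real (dim_level \<Omega> (R i) (levels (R i)))" for i
  define g where "g i = dim_per_proc \<Omega> (R i)" for i
  define W where "W i p = processor_work \<Omega> (R i) (bvp i) (evp i) (jobs i) p" for i p
  define q where "q i k = (1 / real \<beta>) ^ (CARD('d) * (levels (R i) - k))" for i k
  define n where "n i = levels (R i)" for i
  define m where "m i = nproc (R i)" for i
  define L where "L i k j = real (dim_local \<Omega> (R i) k j)" for i k j
  have d: "1 \<le> CARD('d)"
    using dim by auto
  have n1: "1 \<le> n i" and m1: "1 \<le> m i" if "i \<in> I" for i
    using run[OF that]
    by (auto simp: n_def m_def multilevel_correction_def mesh_hierarchy_def decomposition_def)
  have N2: "2 \<le> N i" if "i \<in> I" for i
    using nontrivial[OF that] by (simp add: N_def)
  have g_eq: "g i = N i / real (m i)" for i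
    by (simp add: g_def N_def m_def dim_per_proc_def)
  have g_pos: "0 < g i" and g_le: "g i \<le> N i" if "i \<in> I" for i
    using N2[OF that] m1[OF that] by (auto simp: g_eq field_simps)
  have q_nonneg: "0 \<le> q i k" for i k
    by (simp add: q_def)
  have L_nonneg: "0 \<le> L i k j" for i k j
    by (simp add: L_def)

  \<comment> \<open>Both directions of each equivalence matter: \<open>a\<close> and
    \<open>b\<close> bound dimensions, hence work, from above; \<open>a'\<close> and
    \<open>b'\<close> serve to exclude a zero local dimension on level 1.\<close>
  obtain a where a: "0 < a" "\<And>i k j. i \<in> I \<Longrightarrow> k \<in> {1..n i} \<Longrightarrow> j \<in> {1..m i + 1} \<Longrightarrow>
      L i k j \<le> a * (q i k * L i (n i) j)"
    using dims_levels unfolding bigtheta_principal_iff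
    by (fastforce simp: L_def q_def n_def m_def abs_mult)
  obtain a' where a': "0 < a'" "\<And>i k j. i \<in> I \<Longrightarrow> k \<in> {1..n i} \<Longrightarrow> j \<in> {1..m i + 1} \<Longrightarrow>
      q i k * L i (n i) j \<le> a' * L i k j"
    using dims_levels unfolding bigtheta_principal_iff
    by (fastforce simp: L_def q_def n_def m_def abs_mult)
  obtain b where b: "0 < b" "\<And>i k j. i \<in> I \<Longrightarrow> k \<in> {1..n i} \<Longrightarrow> j \<in> {1..m i + 1} \<Longrightarrow>
      L i k j \<le> b * (real (dim_level \<Omega> (R i) k) / real (m i))"
    using dims_local unfolding bigtheta_principal_iff
    by (fastforce simp: L_def m_def n_def)
  obtain b' where b': "0 < b'" "\<And>i k j. i \<in> I \<Longrightarrow> k \<in> {1..n i} \<Longrightarrow> j \<in> {1..m i + 1} \<Longrightarrow>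
      real (dim_level \<Omega> (R i) k) / real (m i) \<le> b' * L i k j"
    using dims_local unfolding bigtheta_principal_iff
    by (fastforce simp: L_def m_def n_def)
  obtain c where c: "0 < c" "\<And>i k. i \<in> I \<Longrightarrow> k \<in> {2..n i} \<Longrightarrow>
      \<bar>evp i (aug_space \<Omega> (R i) k)\<bar> \<le> c * M_H i"
    using work_augmented M_nonneg unfolding bigo_principal_iff
    by (fastforce simp: n_def)
  obtain e where e: "0 < e" "\<And>i. i \<in> I \<Longrightarrow>
      \<bar>evp i (V0 \<Omega> (fmesh (R i) 1) \<Omega>)\<bar> \<le> e * M_h1 i"
    using work_first M_nonneg unfolding bigo_principal_iff
    by fastforce
  obtain f where f: "0 < f" "\<And>i k j. i \<in> I \<Longrightarrow> k \<in> {1..n i} \<Longrightarrow> j \<in> {1..m i + 1} \<Longrightarrow>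
      \<bar>bvp i (V0 \<Omega> (fmesh (R i) k) (region \<Omega> (R i) j))\<bar> \<le> f * L i k j"
    using work_local unfolding bigo_principal_iff
    by (fastforce simp: L_def n_def m_def)

  \<comment> \<open>Local dimensions compared with the share per processor\<close>
  have finest: "L i (n i) j \<le> b * g i" "g i \<le> b' * L i (n i) j"
    if "i \<in> I" "j \<in> {1..m i + 1}" for i j
    using b(2)[of i "n i" j] b'(2)[of i "n i" j] n1[of i] that
    by (auto simp: g_eq N_def n_def)
  have decay: "L i k j \<le> a * b * g i * q i k"
    if "i \<in> I" "k \<in> {1..n i}" "j \<in> {1..m i + 1}" for i k j
  proof -
    have "L i k j \<le> a * (q i k * L i (n i) j)"
      using a(2) that by blast
    also have "\<dots> \<le> a * (q i k * (b * g i))"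
      using finest(1) that a(1) q_nonneg by (intro mult_left_mono) auto
    finally show ?thesis by (simp add: mult_ac)
  qed

  \<comment> \<open>Number of correction steps\<close>
  define \<kappa> where "\<kappa> = (\<bar>ln (a * b)\<bar> / ln 2 + 1) / ln 2"
  have \<kappa>: "0 \<le> \<kappa>"
    by (simp add: \<kappa>_def)
  have steps: "real (n i - 1) \<le> \<kappa> * ln (2 + g i)" if i: "i \<in> I" for i
  proof -
    \<comment> \<open>A zero on level 1 would propagate through \<open>a'\<close> to the finest
      level and through \<open>b'\<close> to \<open>g i\<close>, which is positive. Being a natural
      number, the dimension is then at least 1.\<close>
    have "L i 1 1 \<noteq> 0"
    proof
      assume "L i 1 1 = 0"
      with a'(2)[of i 1 1] i n1[OF i] L_nonneg[of i "n i" 1] q_nonneg[of i 1]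
      have "q i 1 * L i (n i) 1 \<le> 0"
        by simp
      moreover have "0 < q i 1"
        using beta by (simp add: q_def)
      ultimately have "L i (n i) 1 \<le> 0"
        by (simp add: mult_le_0_iff)
      then have "b' * L i (n i) 1 \<le> 0"
        using b'(1) by (simp add: mult_le_0_iff)
      with finest(2)[of i 1] i g_pos[OF i] show False
        by simp
    qed
    then have "1 \<le> L i 1 1"
      by (simp add: L_def)
    also have "\<dots> \<le> a * b * g i * q i 1"
      using decay[of i 1 1] i n1[OF i] by simp
    \<comment> \<open>The exponent counts refinements from level 1 to level \<open>n i\<close>, that
      is, correction steps; \<open>a * b\<close> plays the part of \<open>K\<close>.\<close>
    finally have "1 \<le> (a * b) * (1 / real \<beta>) ^ (CARD('d) * (n i - 1)) * g i"
      by (simp add: q_def n_def mult_ac)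
    from levels_le_ln[OF beta d _ _ this] g_pos[OF i] a(1) b(1) show ?thesis
      by (simp add: \<kappa>_def)
  qed

  \<comment> \<open>Local boundary value problems of one step\<close>
  have local_work: "\<bar>\<Sum>j\<in>jobs i k p. bvp i (V0 \<Omega> (fmesh (R i) (k + 1)) (region \<Omega> (R i) j))\<bar>
      \<le> real B * f * a * b * g i * q i (k + 1)"
    if "i \<in> I" "p \<in> {1..m i}" "k \<in> {1..<n i}" for i p k
  proof -
    have jobs: "jobs i k p \<subseteq> {1..m i + 1}" "card (jobs i k p) \<le> B"
    proof -
      \<comment> \<open>The jobs of all processors together exhaust exactly the regions, so each
        single job has an index to which \<open>f\<close> and \<open>decay\<close> apply.\<close>
      have "(\<Union>p\<in>{1..m i}. jobs i k p) = {1..m i + 1}"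
        and card: "\<forall>p\<in>{1..m i}. card (jobs i k p) \<le> B"
        using distributed[OF that(1)] that(3)
        unfolding job_distribution_def m_def n_def by blast+
      then show "jobs i k p \<subseteq> {1..m i + 1}"
        using that(2) by blast
      show "card (jobs i k p) \<le> B"
        using card that(2) by blast
    qed
    have "\<bar>\<Sum>j\<in>jobs i k p. bvp i (V0 \<Omega> (fmesh (R i) (k + 1)) (region \<Omega> (R i) j))\<bar>
        \<le> (\<Sum>j\<in>jobs i k p. \<bar>bvp i (V0 \<Omega> (fmesh (R i) (k + 1)) (region \<Omega> (R i) j))\<bar>)"
      by (rule sum_abs)
    also have "\<dots> \<le> (\<Sum>j\<in>jobs i k p. f * (a * b * g i * q i (k + 1)))"
    proof (rule sum_mono)
      fix j assume "j \<in> jobs i k p"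
      then have j: "j \<in> {1..m i + 1}"
        using jobs by auto
      have "\<bar>bvp i (V0 \<Omega> (fmesh (R i) (k + 1)) (region \<Omega> (R i) j))\<bar> \<le> f * L i (k + 1) j"
        using f(2)[of i "k + 1" j] that j by simp
      also have "\<dots> \<le> f * (a * b * g i * q i (k + 1))"
        using decay[of i "k + 1" j] that j f(1) by (intro mult_left_mono) auto
      finally show "\<bar>bvp i (V0 \<Omega> (fmesh (R i) (k + 1)) (region \<Omega> (R i) j))\<bar>
          \<le> f * (a * b * g i * q i (k + 1))" .
    qed
    also have "\<dots> = real (card (jobs i k p)) * (f * (a * b * g i * q i (k + 1)))"
      by simp
    also have "\<dots> \<le> real B * (f * (a * b * g i * q i (k + 1)))"
      using jobs f(1) a(1) b(1) g_pos[OF that(1)] q_nonneg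
      by (intro mult_right_mono mult_nonneg_nonneg) auto
    finally show ?thesis by (simp add: mult_ac)
  qed

  \<comment> \<open>Total work of a processor\<close>
  define C where "C = max e (max (2 * real B * f * a * b) (c * \<kappa>))"
  \<comment> \<open>\<open>e\<close> pays for the first eigenvalue problem;
    \<open>2 * real B * f * a * b\<close> for the local problems, the 2 being the geometric sum;
    \<open>c * \<kappa>\<close> for the augmented eigenvalue problems. Positivity comes from
    \<open>e\<close>.\<close>
  have C: "0 < C" "e \<le> C" "2 * real B * f * a * b \<le> C" "c * \<kappa> \<le> C"
    using e(1) by (auto simp: C_def)
  have work: "\<bar>W i p\<bar> \<le> C * (g i + M_H i * ln (2 + g i) + M_h1 i)"
    if i: "i \<in> I" and p: "p \<in> {1..m i}" for i p
  proof -
    note pos = g_pos[OF i] M_nonneg[OF i]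
    have "\<bar>W i p\<bar> \<le> \<bar>evp i (V0 \<Omega> (fmesh (R i) 1) \<Omega>)\<bar> + (\<Sum>k\<in>{1..<n i}.
        \<bar>(\<Sum>j\<in>jobs i k p. bvp i (V0 \<Omega> (fmesh (R i) (k + 1)) (region \<Omega> (R i) j))) +
          evp i (aug_space \<Omega> (R i) (k + 1))\<bar>)"
      unfolding W_def processor_work_def n_def
      by (intro order_trans[OF abs_triangle_ineq] add_left_mono sum_abs)
    also have "\<dots> \<le> e * M_h1 i +
        (\<Sum>k\<in>{1..<n i}. real B * f * a * b * g i * q i (k + 1) + c * M_H i)"
      using i p
      by (intro add_mono e sum_mono order_trans[OF abs_triangle_ineq] local_work c) auto
    \<comment> \<open>The local costs keep their decaying factor, whereas the augmented problems
      cost the same on every level and so contribute the number of steps.\<close>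
    also have "\<dots> = e * M_h1 i + real B * f * a * b * g i * (\<Sum>k\<in>{1..<n i}. q i (k + 1))
        + c * M_H i * real (n i - 1)"
      by (simp add: sum.distrib sum_distrib_left mult_ac)
    also have "\<dots> \<le> e * M_h1 i + real B * f * a * b * g i * 2
        + c * M_H i * (\<kappa> * ln (2 + g i))"
      using sum_inverse_powers_le[OF beta d, of "n i"] steps[OF i] pos a(1) b(1) c(1) f(1)
      by (intro add_mono mult_left_mono order_refl mult_nonneg_nonneg) (auto simp: q_def n_def)
    also have "\<dots> = e * M_h1 i + (2 * real B * f * a * b) * g i
        + (c * \<kappa>) * (M_H i * ln (2 + g i))"
      by (simp add: mult_ac)
    also have "\<dots> \<le> C * M_h1 i + C * g i + C * (M_H i * ln (2 + g i))"
      using C pos by (intro add_mono mult_right_mono mult_nonneg_nonneg) auto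
    finally show ?thesis by (simp add: algebra_simps)
  qed

  \<comment> \<open>The two asymptotic bounds\<close>
  have first: "\<bar>W i p\<bar> \<le> 2 * C * \<bar>g i + M_H i * ln (N i) + M_h1 i\<bar>"
    if i: "i \<in> I" and p: "p \<in> {1..m i}" for i p
  proof -
    note pos = g_pos[OF i] M_nonneg[OF i] N2[OF i]
    have "M_H i * ln (2 + g i) \<le> M_H i * (2 * ln (N i))"
      using ln_two_plus_le[of "N i" "g i"] g_le[OF i] pos by (intro mult_left_mono) auto
    then have "g i + M_H i * ln (2 + g i) + M_h1 i \<le> 2 * (g i + M_H i * ln (N i) + M_h1 i)"
      using pos by simp
    then have "C * (g i + M_H i * ln (2 + g i) + M_h1 i)
        \<le> C * (2 * \<bar>g i + M_H i * ln (N i) + M_h1 i\<bar>)"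
      using C(1) by (intro mult_left_mono order_trans[OF _ mult_left_mono[OF abs_ge_self]]) auto
    with work[OF i p] show ?thesis by simp
  qed

  have second: "\<bar>W i p\<bar> \<le> C * (s + 2) * \<bar>g i\<bar>"
    if i: "i \<in> I" and p: "p \<in> {1..m i}"
      and s: "\<bar>M_H i\<bar> \<le> s * \<bar>g i / ln (2 + g i)\<bar>" and h1: "M_h1 i \<le> g i" for i p s
  proof -
    note pos = g_pos[OF i] M_nonneg[OF i]
    have "0 < ln (2 + g i)"
      using pos by simp
    \<comment> \<open>The logarithm in the denominator of \<open>much_smaller\<close> cancels the
      one from the step count. With \<open>M_h1 i \<le> g i\<close> the three terms add up to
      \<open>s + 2\<close> multiples of \<open>g i\<close>.\<close>
    then have "M_H i * ln (2 + g i) \<le> s * g i"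
      using s pos by (simp add: field_simps)
    then have "C * (g i + M_H i * ln (2 + g i) + M_h1 i) \<le> C * ((s + 2) * g i)"
      using C(1) h1 by (intro mult_left_mono) (auto simp: algebra_simps)
    with work[OF i p] show ?thesis
      using pos by (simp add: mult_ac)
  qed

  show ?thesis
    unfolding W_def[symmetric] g_def[symmetric] N_def[symmetric] m_def[symmetric]
  proof (intro conjI impI)
    show "(\<lambda>(i, p). W i p)
        \<in> O[principal {(i, p). i \<in> I \<and> p \<in> {1..m i}}](\<lambda>(i, p). g i + M_H i * ln (N i) + M_h1 i)"
      unfolding bigo_principal_iff using first C(1)
      by (intro exI[of _ "2 * C"]) auto
  next
    assume "much_smaller I M_H g \<and> (\<forall>i\<in>I. M_h1 i \<le> g i)"
    then obtain s where "0 < s" "\<And>i. i \<in> I \<Longrightarrow> \<bar>M_H i\<bar> \<le> s * \<bar>g i / ln (2 + g i)\<bar>"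
      and "\<And>i. i \<in> I \<Longrightarrow> M_h1 i \<le> g i"
      unfolding much_smaller_def bigo_principal_iff by blast
    then show "(\<lambda>(i, p). W i p)
        \<in> O[principal {(i, p). i \<in> I \<and> p \<in> {1..m i}}](\<lambda>(i, p). g i)"
      unfolding bigo_principal_iff using second C(1)
      by (intro exI[of _ "C * (s + 2)"]) auto
  qed
qed

end
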